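(* Let $(M,g)$ be a smooth Riemannian manifold and let $\mathcal{D}\subseteq TM$ be a regular distribution. Then $\mathcal{D}$ is involutive if and only if for every $Z\in\Gamma(\mathcal{D}^{\bot})$ the tensor field $B_Z:\Gamma(\mathcal{D})\times\Gamma(\mathcal{D})\to\mathcal{C}^{\infty}(M)$ is symmetric; that is, if and only if for every $Z\in\Gamma(\mathcal{D}^{\bot})$ the $2$-form $\mathrm{d}(\mathrm{i}_Z g)$ vanishes on sections of $\mathcal{D}$, i.e. $(\mathrm{d}(\mathrm{i}_Z g))(X,Y)=0$ for all $X,Y\in\Gamma(\mathcal{D})$.
   Context: All objects are $\mathcal{C}^\infty$. $(M,g)$ is a Riemannian manifold of dimension $m$ with Levi-Civita connection $\nabla$. A regular distribution $\mathcal{D}\subseteq TM$ is a smooth subbundle of $TM$ of constant rank $n$; $\mathcal{D}^{\bot}$ is its $g$-orthogonal complement; $\Gamma(\cdot)$ denotes the $\mathcal{C}^\infty(M)$-module of smooth sections; $\pi^{\mathcal{D}^{\bot}}:TM\to\mathcal{D}^{\bot}$ is the orthogonal projection. The second fundamental form of $\mathcal{D}$ is $B(X,Y)=\pi^{\mathcal{D}^{\bot}}(\nabla_XY)$ for $X,Y\in\Gamma(\mathcal{D})$; it is not necessarily symmetric. For $Z\in\Gamma(\mathcal{D}^{\bot})$, $B_Z(X,Y)=g(B(X,Y),Z)$ for $X,Y\in\Gamma(\mathcal{D})$. $\mathrm{i}_Zg$ is the $1$-form $Y\mapsto g(Z,Y)$. For a $1$-form $\alpha$, $\mathrm{d}\alpha(X,Y)=X(\alpha(Y))-Y(\alpha(X))-\alpha([X,Y])$.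 $\mathcal{D}$ is involutive if $[X,Y]\in\Gamma(\mathcal{D})$ for all $X,Y\in\Gamma(\mathcal{D})$. *)

theory Defs
  imports "HOL-Analysis.Analysis" "HOL-Library.Function_Algebras"
begin

text \<open>Pointwise real vector space structure on functions. It makes the library notions
  \<^const>\<open>subspace\<close>, \<^const>\<open>span\<close> and \<^const>\<open>independent\<close> available for tangent vectors,
  which are functionals on germs of functions.\<close>

instantiation "fun" :: (type, real_vector) real_vector
begin

definition scaleR_fun :: "real \<Rightarrow> ('a \<Rightarrow> 'b) \<Rightarrow> 'a \<Rightarrow> 'b"
  where "scaleR_fun c f = (\<lambda>x. c *\<^sub>R f x)"

instance
  by standard (auto simp: scaleR_fun_def fun_eq_iff scaleR_add_right scaleR_add_left)

end

lemma scaleR_fun_apply [simp]: "(c *\<^sub>R f) x = c *\<^sub>R f x"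
  by (simp add: scaleR_fun_def)


section \<open>Smooth manifolds\<close>

text \<open>Only used for open \<open>S\<close>.\<close>

primrec Ck_on :: "nat \<Rightarrow> 'a::real_normed_vector set \<Rightarrow> ('a \<Rightarrow> 'b::real_normed_vector) \<Rightarrow> bool"
  where
    "Ck_on 0 S f \<longleftrightarrow> continuous_on S f"
  | "Ck_on (Suc k) S f \<longleftrightarrow> (\<forall>x\<in>S. f differentiable (at x)) \<and>
       (\<forall>v. Ck_on k S (\<lambda>x. frechet_derivative f (at x) v))"

definition smooth_on :: "'a::real_normed_vector set \<Rightarrow> ('a \<Rightarrow> 'b::real_normed_vector) \<Rightarrow> bool"
  where "smooth_on S f \<longleftrightarrow> (\<forall>k. Ck_on k S f)"

text \<open>A manifold is a topological space with an atlas of charts \<open>(W, \<phi>)\<close>, \<open>\<phi>\<close> being relevant on \<open>W\<close> only.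
  The model space \<open>'e\<close> is an arbitrary finite-dimensional real inner product space, that is,
  a Euclidean space; the class \<^class>\<open>euclidean_space\<close> is not used because it would exclude dimension 0.\<close>

record ('a, 'e) manifold =
  space_of :: "'a topology"
  atlas :: "('a set \<times> ('a \<Rightarrow> 'e)) set"

abbreviation points :: "('a, 'e) manifold \<Rightarrow> 'a set"
  where "points M \<equiv> topspace (space_of M)"

abbreviation open_in :: "('a, 'e) manifold \<Rightarrow> 'a set \<Rightarrow> bool"
  where "open_in M \<equiv> openin (space_of M)"

definition smooth_manifold :: "('a, 'e::real_inner) manifold \<Rightarrow> bool"
  where "smooth_manifold M \<longleftrightarrow>
    (\<exists>B::'e set. finite B \<and> span B = UNIV) \<and>
    Hausdorff_space (space_of M) \<and> second_countable (space_of M) \<and>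
    (\<Union>(W, \<phi>)\<in>atlas M. W) = points M \<and>
    (\<forall>(W, \<phi>)\<in>atlas M. open_in M W \<and> open (\<phi> ` W) \<and>
       homeomorphic_map (subtopology (space_of M) W) (top_of_set (\<phi> ` W)) \<phi>) \<and>
    (\<forall>(W, \<phi>)\<in>atlas M. \<forall>(W', \<phi>')\<in>atlas M. smooth_on (\<phi> ` (W \<inter> W')) (\<phi>' \<circ> inv_into W \<phi>))"

definition smooth_fun_on :: "('a, 'e::real_inner) manifold \<Rightarrow> 'a set \<Rightarrow> ('a \<Rightarrow> real) \<Rightarrow> bool"
  where "smooth_fun_on M U f \<longleftrightarrow>
    (\<forall>(W, \<phi>)\<in>atlas M. smooth_on (\<phi> ` (W \<inter> U)) (f \<circ> inv_into W \<phi>))"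

definition smooth_near :: "('a, 'e::real_inner) manifold \<Rightarrow> 'a \<Rightarrow> ('a \<Rightarrow> real) \<Rightarrow> bool"
  where "smooth_near M p f \<longleftrightarrow> (\<exists>U. open_in M U \<and> p \<in> U \<and> smooth_fun_on M U f)"


section \<open>Tangent vectors and vector fields\<close>

type_synonym 'a tangent = "('a \<Rightarrow> real) \<Rightarrow> real"
type_synonym 'a vector_field = "'a \<Rightarrow> 'a tangent"

text \<open>Tangent vectors at \<open>p\<close> are the derivations of the germs at \<open>p\<close> of smooth functions. That they depend
  on germs only follows from the product rule: if \<open>f\<close> vanishes near \<open>p\<close>, then \<open>f = f * h\<close> for some
  \<open>h\<close> that vanishes near \<open>p\<close>. The last clause normalises them to \<open>0\<close> off the smooth germs, so that
  equal tangent vectors are equal functions.\<close>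

definition tangent_space :: "('a, 'e::real_inner) manifold \<Rightarrow> 'a \<Rightarrow> 'a tangent set"
  where "tangent_space M p = {v.
    (\<forall>f h. smooth_near M p f \<longrightarrow> smooth_near M p h \<longrightarrow>
       v (\<lambda>x. f x + h x) = v f + v h \<and> v (\<lambda>x. f x * h x) = f p * v h + h p * v f) \<and>
    (\<forall>c f. smooth_near M p f \<longrightarrow> v (\<lambda>x. c * f x) = c * v f) \<and>
    (\<forall>f. \<not> smooth_near M p f \<longrightarrow> v f = 0)}"

definition deriv_along :: "'a vector_field \<Rightarrow> ('a \<Rightarrow> real) \<Rightarrow> 'a \<Rightarrow> real"
  where "deriv_along X f = (\<lambda>p. X p f)"

definition vector_fields_on :: "('a, 'e::real_inner) manifold \<Rightarrow> 'a set \<Rightarrow> 'a vector_field set"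
  where "vector_fields_on M U = {X. (\<forall>p\<in>U. X p \<in> tangent_space M p) \<and>
    (\<forall>W f. open_in M W \<longrightarrow> W \<subseteq> U \<longrightarrow> smooth_fun_on M W f \<longrightarrow> smooth_fun_on M W (deriv_along X f))}"

text \<open>Global fields are extended by \<open>0\<close> outside the manifold, so that they are equal as functions
  iff they agree on the manifold.\<close>

definition vector_fields :: "('a, 'e::real_inner) manifold \<Rightarrow> 'a vector_field set"
  where "vector_fields M = {X \<in> vector_fields_on M (points M). \<forall>p. p \<notin> points M \<longrightarrow> X p = 0}"

definition fun_smult :: "('a \<Rightarrow> real) \<Rightarrow> 'a vector_field \<Rightarrow> 'a vector_field"
  where "fun_smult f X = (\<lambda>p. f p *\<^sub>R X p)"

definition bracket ::
    "('a, 'e::real_inner) manifold \<Rightarrow> 'a vector_field \<Rightarrow> 'a vector_field \<Rightarrow> 'a vector_field"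
  where "bracket M X Y = (\<lambda>p f.
    if smooth_near M p f then X p (deriv_along Y f) - Y p (deriv_along X f) else 0)"


section \<open>Riemannian metrics and the Levi-Civita connection\<close>

type_synonym 'a metric_field = "'a \<Rightarrow> 'a tangent \<Rightarrow> 'a tangent \<Rightarrow> real"

definition riemannian_metric :: "('a, 'e::real_inner) manifold \<Rightarrow> 'a metric_field \<Rightarrow> bool"
  where "riemannian_metric M g \<longleftrightarrow>
    (\<forall>p\<in>points M.
       (\<forall>u\<in>tangent_space M p. \<forall>v\<in>tangent_space M p. \<forall>w\<in>tangent_space M p. \<forall>c.
          g p (u + v) w = g p u w + g p v w \<and> g p (c *\<^sub>R u) w = c * g p u w) \<and>
       (\<forall>u\<in>tangent_space M p. \<forall>v\<in>tangent_space M p. g p u v = g p v u) \<and>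
       (\<forall>u\<in>tangent_space M p. u \<noteq> 0 \<longrightarrow> g p u u > 0)) \<and>
    (\<forall>U. open_in M U \<longrightarrow> (\<forall>X\<in>vector_fields_on M U. \<forall>Y\<in>vector_fields_on M U.
       smooth_fun_on M U (\<lambda>p. g p (X p) (Y p))))"

type_synonym 'a connection = "'a vector_field \<Rightarrow> 'a vector_field \<Rightarrow> 'a vector_field"

definition affine_connection :: "('a, 'e::real_inner) manifold \<Rightarrow> 'a connection \<Rightarrow> bool"
  where "affine_connection M nabla \<longleftrightarrow>
    (\<forall>X\<in>vector_fields M. \<forall>Y\<in>vector_fields M. nabla X Y \<in> vector_fields M) \<and>
    (\<forall>X\<in>vector_fields M. \<forall>X'\<in>vector_fields M. \<forall>Y\<in>vector_fields M.
       nabla (X + X') Y = nabla X Y + nabla X' Y \<and> nabla Y (X + X') = nabla Y X + nabla Y X') \<and>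
    (\<forall>f. smooth_fun_on M (points M) f \<longrightarrow> (\<forall>X\<in>vector_fields M. \<forall>Y\<in>vector_fields M.
       nabla (fun_smult f X) Y = fun_smult f (nabla X Y) \<and>
       nabla X (fun_smult f Y) = fun_smult (deriv_along X f) Y + fun_smult f (nabla X Y)))"

text \<open>These conditions determine \<open>nabla\<close> uniquely on \<^const>\<open>vector_fields\<close>.\<close>

definition levi_civita_connection ::
    "('a, 'e::real_inner) manifold \<Rightarrow> 'a metric_field \<Rightarrow> 'a connection \<Rightarrow> bool"
  where "levi_civita_connection M g nabla \<longleftrightarrow>
    affine_connection M nabla \<and>
    (\<forall>X\<in>vector_fields M. \<forall>Y\<in>vector_fields M. nabla X Y - nabla Y X = bracket M X Y) \<and>
    (\<forall>X\<in>vector_fields M. \<forall>Y\<in>vector_fields M. \<forall>Z\<in>vector_fields M. \<forall>p\<in>points M.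
       deriv_along X (\<lambda>q. g q (Y q) (Z q)) p = g p (nabla X Y p) (Z p) + g p (Y p) (nabla X Z p))"


section \<open>Distributions\<close>

text \<open>A distribution assigns to each point a set of tangent vectors there. It is a smooth subbundle of
  rank \<open>n\<close> iff it has smooth local frames of length \<open>n\<close>; its fibres are then \<open>n\<close>-dimensional
  subspaces of the tangent spaces.\<close>

type_synonym 'a distribution = "'a \<Rightarrow> 'a tangent set"

definition regular_distribution ::
    "('a, 'e::real_inner) manifold \<Rightarrow> nat \<Rightarrow> 'a distribution \<Rightarrow> bool"
  where "regular_distribution M n D \<longleftrightarrow>
    (\<forall>p\<in>points M. \<exists>U E. open_in M U \<and> p \<in> U \<and>
       (\<forall>i<n. E i \<in> vector_fields_on M U) \<and>
       (\<forall>q\<in>U. inj_on (\<lambda>i. E i q) {..<n} \<and> independent ((\<lambda>i. E i q) ` {..<n}) \<and>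
          span ((\<lambda>i. E i q) ` {..<n}) = D q))"

definition sections :: "('a, 'e::real_inner) manifold \<Rightarrow> 'a distribution \<Rightarrow> 'a vector_field set"
  where "sections M D = {X \<in> vector_fields M. \<forall>p\<in>points M. X p \<in> D p}"

definition involutive :: "('a, 'e::real_inner) manifold \<Rightarrow> 'a distribution \<Rightarrow> bool"
  where "involutive M D \<longleftrightarrow> (\<forall>X\<in>sections M D. \<forall>Y\<in>sections M D. bracket M X Y \<in> sections M D)"

definition orth_complement ::
    "('a, 'e::real_inner) manifold \<Rightarrow> 'a metric_field \<Rightarrow> 'a distribution \<Rightarrow> 'a distribution"
  where "orth_complement M g D p = {v \<in> tangent_space M p. \<forall>w\<in>D p. g p v w = 0}"

definition orth_proj_complement ::
    "('a, 'e::real_inner) manifold \<Rightarrow> 'a metric_field \<Rightarrow> 'a distribution \<Rightarrow> 'a \<Rightarrow> 'a tangent \<Rightarrow> 'a tangent"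
  where "orth_proj_complement M g D p v = (THE w. w \<in> orth_complement M g D p \<and> v - w \<in> D p)"

definition second_fundamental_form ::
    "('a, 'e::real_inner) manifold \<Rightarrow> 'a metric_field \<Rightarrow> 'a connection \<Rightarrow> 'a distribution \<Rightarrow>
     'a vector_field \<Rightarrow> 'a vector_field \<Rightarrow> 'a vector_field"
  where "second_fundamental_form M g nabla D X Y =
    (\<lambda>p. orth_proj_complement M g D p (nabla X Y p))"

definition second_fundamental_form_along ::
    "('a, 'e::real_inner) manifold \<Rightarrow> 'a metric_field \<Rightarrow> 'a connection \<Rightarrow> 'a distribution \<Rightarrow>
     'a vector_field \<Rightarrow> 'a vector_field \<Rightarrow> 'a vector_field \<Rightarrow> 'a \<Rightarrow> real"
  where "second_fundamental_form_along M g nabla D Z X Y =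
    (\<lambda>p. g p (second_fundamental_form M g nabla D X Y p) (Z p))"


section \<open>One-forms\<close>

type_synonym 'a one_form = "'a \<Rightarrow> 'a tangent \<Rightarrow> real"

definition interior_metric :: "'a metric_field \<Rightarrow> 'a vector_field \<Rightarrow> 'a one_form"
  where "interior_metric g Z = (\<lambda>p v. g p (Z p) v)"

definition ext_deriv ::
    "('a, 'e::real_inner) manifold \<Rightarrow> 'a one_form \<Rightarrow> 'a vector_field \<Rightarrow> 'a vector_field \<Rightarrow> 'a \<Rightarrow> real"
  where "ext_deriv M \<alpha> X Y = (\<lambda>p.
    deriv_along X (\<lambda>q. \<alpha> q (Y q)) p - deriv_along Y (\<lambda>q. \<alpha> q (X q)) p - \<alpha> p (bracket M X Y p))"

end

theory Submission
  imports Defs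
begin

text \<open>Since \<open>\<nabla>\<close> is torsion-free and \<open>Z\<close> is orthogonal to \<open>D\<close>, the antisymmetric part of
  \<open>B\<^sub>Z(X, Y)\<close> is \<open>g([X, Y], Z)\<close>, and the formula for \<open>d(i\<^sub>Z g)(X, Y)\<close> reduces to \<open>- g(Z, [X, Y])\<close>.
  Both conditions therefore say that \<open>[X, Y]\<close> is orthogonal to all sections of the complement of \<open>D\<close>.
  One of these sections is the orthogonal projection of \<open>[X, Y]\<close> itself, which then has to vanish.
  It is smooth because locally it is given by the Gram-Schmidt process for a frame of \<open>D\<close>; as it is
  globally defined, no vector has to be extended and no bump functions are needed.\<close>


section \<open>Calculus of smooth functions\<close>

lemma Ck_on_subset: "Ck_on k S f \<Longrightarrow> T \<subseteq> S \<Longrightarrow> Ck_on k T f"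
  by (induction k arbitrary: f) (auto intro: continuous_on_subset)

text \<open>\<open>Ck_on (Suc k)\<close> only speaks of the derivatives, so this descent has to be
  proved. The product and inverse rules rely on it, since their derivatives still contain the
  undifferentiated function.\<close>

lemma Ck_on_Suc_imp_Ck_on: "Ck_on (Suc k) S f \<Longrightarrow> Ck_on k S f"
proof (induction k arbitrary: f)
  case 0
  then show ?case
    by (auto intro!: continuous_at_imp_continuous_on differentiable_imp_continuous_within)
next
  case (Suc k)
  have "Ck_on k S (\<lambda>x. frechet_derivative f (at x) v)" for v
    using Suc.prems by (intro Suc.IH) (simp add: Ck_on.simps)
  with Suc.prems show ?case by simp
qed

lemma has_derivative_cong_open:
  assumes "open S" "x \<in> S" "\<And>y. y \<in> S \<Longrightarrow> f y = h y" "(f has_derivative d) (at x)"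
  shows "(h has_derivative d) (at x)"
  using has_derivative_transform_within_open[OF assms(4,1,2)] assms(3) by simp

text \<open>Derivatives are taken at \<open>x\<close> in the full space and depend on all values
  near \<open>x\<close>. As \<open>S\<close> is open, agreement on \<open>S\<close> is agreement
  near each of its points.\<close>

lemma Ck_on_cong:
  assumes "open S" "\<And>x. x \<in> S \<Longrightarrow> f x = h x" "Ck_on k S f"
  shows "Ck_on k S h"
  using assms(2,3)
proof (induction k arbitrary: f h)
  case 0
  then show ?case
    using continuous_on_cong[of S S f h] by simp
next
  case (Suc k)
  have D: "(h has_derivative frechet_derivative f (at x)) (at x)" if "x \<in> S" for x
    using has_derivative_cong_open[OF \<open>open S\<close> that Suc.prems(1)] Suc.prems(2) that
      frechet_derivative_works[of f "at x"] by auto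
  have "Ck_on k S (\<lambda>x. frechet_derivative h (at x) v)" for v
    by (rule Suc.IH[of "\<lambda>x. frechet_derivative f (at x) v"])
       (use Suc.prems(2) frechet_derivative_at[OF D] in auto)
  then show ?case
    using D by (auto simp: differentiable_def)
qed

text \<open>Uniqueness of the derivative lets an explicitly computed \<open>f'\<close> replace the
  chosen \<open>frechet_derivative\<close>. The closure rules below all reduce to this form.\<close>

lemma Ck_on_SucI:
  assumes "open S" "\<And>x. x \<in> S \<Longrightarrow> (f has_derivative f' x) (at x)"
    and "\<And>v. Ck_on k S (\<lambda>x. f' x v)"
  shows "Ck_on (Suc k) S f"
proof -
  have "Ck_on k S (\<lambda>x. frechet_derivative f (at x) v)" for v
    by (rule Ck_on_cong[OF assms(1) _ assms(3)[of v]])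
       (use frechet_derivative_at[OF assms(2)] in auto)
  then show ?thesis
    using assms(2) by (auto simp: differentiable_def)
qed

lemma Ck_on_Suc_has_derivative:
  "Ck_on (Suc k) S f \<Longrightarrow> x \<in> S \<Longrightarrow> (f has_derivative frechet_derivative f (at x)) (at x)"
  by (simp add: frechet_derivative_works)

lemma Ck_on_const: "open S \<Longrightarrow> Ck_on k S (\<lambda>x. c)"
proof (induction k arbitrary: c)
  case (Suc k)
  show ?case
    by (rule Ck_on_SucI[where f' = "\<lambda>x v. 0"]) (use Suc in auto)
qed simp

lemma Ck_on_add:
  assumes "open S"
  shows "Ck_on k S f \<Longrightarrow> Ck_on k S h \<Longrightarrow> Ck_on k S (\<lambda>x. f x + h x)"
proof (induction k arbitrary: f h)
  case 0
  then show ?case by (auto intro: continuous_on_add)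
next
  case (Suc k)
  show ?case
    by (rule Ck_on_SucI[OF assms has_derivative_add[OF Ck_on_Suc_has_derivative[OF Suc.prems(1)]
        Ck_on_Suc_has_derivative[OF Suc.prems(2)]]])
       (use Suc in auto)
qed

lemma Ck_on_mult:
  fixes f h :: "_ \<Rightarrow> real"
  assumes "open S"
  shows "Ck_on k S f \<Longrightarrow> Ck_on k S h \<Longrightarrow> Ck_on k S (\<lambda>x. f x * h x)"
proof (induction k arbitrary: f h)
  case 0
  then show ?case by (auto intro: continuous_on_mult)
next
  case (Suc k)
  show ?case
    by (rule Ck_on_SucI[OF assms has_derivative_mult[OF Ck_on_Suc_has_derivative[OF Suc.prems(1)]
        Ck_on_Suc_has_derivative[OF Suc.prems(2)]]])
       (use Suc.prems Ck_on_Suc_imp_Ck_on[OF Suc.prems(1)] Ck_on_Suc_imp_Ck_on[OF Suc.prems(2)]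
        in \<open>auto intro!: Ck_on_add[OF assms] Suc.IH\<close>)
qed

lemma Ck_on_inverse:
  fixes f :: "_ \<Rightarrow> real"
  assumes "open S" "\<And>x. x \<in> S \<Longrightarrow> f x \<noteq> 0"
  shows "Ck_on k S f \<Longrightarrow> Ck_on k S (\<lambda>x. inverse (f x))"
proof (induction k)
  case 0
  then show ?case using assms by (auto intro: continuous_on_inverse)
next
  case (Suc k)
  \<comment> \<open>The sign is written as the constant factor \<open>- 1\<close>, so that the rules
    for products and constants suffice. The other factors are the inverse at level \<open>k\<close>,
    covered by the induction hypothesis, and a derivative of \<open>f\<close>.\<close>
  let ?f' = "\<lambda>x v. - 1 * (inverse (f x) * frechet_derivative f (at x) v * inverse (f x))"
  have "((\<lambda>x. inverse (f x)) has_derivative ?f' x) (at x)" if "x \<in> S" for x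
    using Deriv.has_derivative_inverse[OF assms(2)[OF that] Ck_on_Suc_has_derivative[OF Suc.prems that]]
    by simp
  moreover have "Ck_on k S (\<lambda>x. ?f' x v)" for v
    using Suc.prems
    by (intro Ck_on_mult[OF assms(1)] Ck_on_const[OF assms(1)] Suc.IH
        Ck_on_Suc_imp_Ck_on[OF Suc.prems]) auto
  ultimately show ?case
    by (rule Ck_on_SucI[OF assms(1)])
qed

text \<open>Continuity and the derivative at a point depend only on the values near it, at every
  order. The neighbourhoods \<open>T\<close> may extend beyond \<open>S\<close>.\<close>

lemma Ck_on_local:
  assumes "\<And>x. x \<in> S \<Longrightarrow> \<exists>T. open T \<and> x \<in> T \<and> Ck_on k T f"
  shows "Ck_on k S f"
  using assms
proof (induction k arbitrary: f)
  case 0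
  have "continuous (at x) f" if "x \<in> S" for x
    using 0[OF that] continuous_on_eq_continuous_at by auto
  then show ?case by (simp add: continuous_at_imp_continuous_on)
next
  case (Suc k)
  have "Ck_on k S (\<lambda>x. frechet_derivative f (at x) v)" for v
    by (rule Suc.IH) (use Suc.prems in fastforce)
  then show ?case using Suc.prems by fastforce
qed


section \<open>Smooth functions and vector fields on manifolds\<close>

text \<open>This transfers the calculus to charts: openness of the chart image makes the
  \<open>Ck_on\<close> rules applicable, and injectivity allows \<open>inv_into W \<phi>\<close> to
  be cancelled.\<close>

lemma smooth_manifold_chart:
  assumes "smooth_manifold M" "(W, \<phi>) \<in> atlas M"
  shows "inj_on \<phi> W" and "open_in M U \<Longrightarrow> open (\<phi> ` (W \<inter> U))"
proof -
  have W: "open_in M W" "open (\<phi> ` W)"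
    and h: "homeomorphic_map (subtopology (space_of M) W) (top_of_set (\<phi> ` W)) \<phi>"
    using assms unfolding smooth_manifold_def by fast+
  have top: "topspace (subtopology (space_of M) W) = W"
    using openin_subset[OF W(1)] by auto
  show "inj_on \<phi> W"
    using homeomorphic_imp_injective_map[OF h] top by simp
  show "open (\<phi> ` (W \<inter> U))" if "open_in M U"
  proof -
    have "openin (subtopology (space_of M) W) (W \<inter> U)"
      using that openin_subtopology_Int2 by blast
    then have "openin (top_of_set (\<phi> ` W)) (\<phi> ` (W \<inter> U))"
      using homeomorphic_imp_open_map[OF h] unfolding open_map_def by blast
    then show ?thesis
      using W(2) openin_open_trans by blast
  qed
qed

section \<open>Smooth real functions on open subsets of a manifold\<close>

lemma smooth_fun_onI:
  assumes "\<And>W \<phi> k. (W, \<phi>) \<in> atlas M \<Longrightarrow> Ck_on k (\<phi> ` (W \<inter> U)) (f \<circ> inv_into W \<phi>)"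
  shows "smooth_fun_on M U f"
  using assms unfolding smooth_fun_on_def smooth_on_def by blast

lemma smooth_fun_onD:
  assumes "smooth_fun_on M U f" "(W, \<phi>) \<in> atlas M"
  shows "Ck_on k (\<phi> ` (W \<inter> U)) (f \<circ> inv_into W \<phi>)"
  using assms unfolding smooth_fun_on_def smooth_on_def by blast

lemma smooth_fun_on_subset:
  "smooth_fun_on M U f \<Longrightarrow> V \<subseteq> U \<Longrightarrow> smooth_fun_on M V f"
  by (rule smooth_fun_onI, rule Ck_on_subset, erule smooth_fun_onD) auto

lemma smooth_fun_on_cong:
  assumes "smooth_manifold M" "open_in M U" "smooth_fun_on M U f" "\<And>x. x \<in> U \<Longrightarrow> f x = h x"
  shows "smooth_fun_on M U h"
proof (rule smooth_fun_onI)
  fix W \<phi> k assume a: "(W, \<phi>) \<in> atlas M"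
  show "Ck_on k (\<phi> ` (W \<inter> U)) (h \<circ> inv_into W \<phi>)"
    by (rule Ck_on_cong[OF smooth_manifold_chart(2)[OF assms(1) a assms(2)] _
          smooth_fun_onD[OF assms(3) a]])
       (use smooth_manifold_chart(1)[OF assms(1) a] assms(4) in auto)
qed

lemma smooth_fun_on_const:
  assumes "smooth_manifold M" "open_in M U"
  shows "smooth_fun_on M U (\<lambda>x. c)"
  using Ck_on_const[OF smooth_manifold_chart(2)[OF assms(1) _ assms(2)]]
  by (intro smooth_fun_onI) (simp add: o_def)

lemma smooth_fun_on_add:
  assumes "smooth_manifold M" "open_in M U" "smooth_fun_on M U f" "smooth_fun_on M U h"
  shows "smooth_fun_on M U (\<lambda>x. f x + h x)"
  using Ck_on_add[OF smooth_manifold_chart(2)[OF assms(1) _ assms(2)]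
      smooth_fun_onD[OF assms(3)] smooth_fun_onD[OF assms(4)]]
  by (intro smooth_fun_onI) (simp add: o_def)

lemma smooth_fun_on_mult:
  assumes "smooth_manifold M" "open_in M U" "smooth_fun_on M U f" "smooth_fun_on M U h"
  shows "smooth_fun_on M U (\<lambda>x. f x * h x)"
  using Ck_on_mult[OF smooth_manifold_chart(2)[OF assms(1) _ assms(2)]
      smooth_fun_onD[OF assms(3)] smooth_fun_onD[OF assms(4)]]
  by (intro smooth_fun_onI) (simp add: o_def)

lemma smooth_fun_on_inverse:
  assumes "smooth_manifold M" "open_in M U" "smooth_fun_on M U f" "\<And>x. x \<in> U \<Longrightarrow> f x \<noteq> 0"
  shows "smooth_fun_on M U (\<lambda>x. inverse (f x))"
proof (rule smooth_fun_onI)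
  fix W \<phi> k assume a: "(W, \<phi>) \<in> atlas M"
  have "(f \<circ> inv_into W \<phi>) x \<noteq> 0" if "x \<in> \<phi> ` (W \<inter> U)" for x
    using that smooth_manifold_chart(1)[OF assms(1) a] assms(4) by auto
  from Ck_on_inverse[OF smooth_manifold_chart(2)[OF assms(1) a assms(2)] this
      smooth_fun_onD[OF assms(3) a]]
  show "Ck_on k (\<phi> ` (W \<inter> U)) ((\<lambda>x. inverse (f x)) \<circ> inv_into W \<phi>)"
    by (simp add: o_def)
qed

lemma smooth_fun_on_local:
  assumes "smooth_manifold M"
    and "\<And>p. p \<in> U \<Longrightarrow> \<exists>V. open_in M V \<and> p \<in> V \<and> smooth_fun_on M V f"
  shows "smooth_fun_on M U f"
proof (intro smooth_fun_onI Ck_on_local)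
  fix W \<phi> k x assume a: "(W, \<phi>) \<in> atlas M" and "x \<in> \<phi> ` (W \<inter> U)"
  then obtain p where p: "p \<in> W" "p \<in> U" "x = \<phi> p" by auto
  then obtain V where "open_in M V" "p \<in> V" "smooth_fun_on M V f"
    using assms(2) by blast
  then show "\<exists>T. open T \<and> x \<in> T \<and> Ck_on k T (f \<circ> inv_into W \<phi>)"
    using p smooth_manifold_chart(2)[OF assms(1) a] smooth_fun_onD[OF _ a]
    by (intro exI[of _ "\<phi> ` (W \<inter> V)"]) auto
qed

section \<open>Tangent vectors and vector fields on open sets\<close>

lemma subspace_tangent_space: "subspace (tangent_space M p)"
  unfolding subspace_def tangent_space_def by (auto simp: algebra_simps)

text \<open>The function \<open>f\<close> agrees with its product by the indicator of the complement of \<open>U\<close>.\<close>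

lemma tangent_space_vanish:
  assumes "smooth_manifold M" "v \<in> tangent_space M p" "open_in M U" "p \<in> U"
    and "\<And>x. x \<in> U \<Longrightarrow> f x = 0"
  shows "v f = 0"
proof -
  define h :: "'a \<Rightarrow> real" where "h = (\<lambda>x. if x \<in> U then 0 else 1)"
  \<comment> \<open>This covers \<open>f\<close> and also the indicator \<open>h\<close>, however
    irregular they are away from \<open>U\<close>: smoothness near \<open>p\<close> can be tested on
    \<open>U\<close>, where both vanish. In the product rule both terms then drop out, because
    \<open>f p\<close> and \<open>h p\<close> are 0.\<close>
  have near: "smooth_near M p k" if "\<And>x. x \<in> U \<Longrightarrow> k x = 0" for k
    using smooth_fun_on_cong[OF assms(1,3) smooth_fun_on_const[OF assms(1,3), of 0], of k]
      that assms(3,4) unfolding smooth_near_def by auto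
  have "smooth_near M p f" "smooth_near M p h"
    by (auto intro!: near assms(5) simp: h_def)
  then have "v (\<lambda>x. f x * h x) = f p * v h + h p * v f"
    using assms(2) unfolding tangent_space_def by blast
  moreover have "(\<lambda>x. f x * h x) = f"
    using assms(5) by (auto simp: h_def fun_eq_iff)
  ultimately show ?thesis
    using assms(4,5) by (simp add: h_def)
qed

lemma vector_fields_on_tangent: "X \<in> vector_fields_on M U \<Longrightarrow> p \<in> U \<Longrightarrow> X p \<in> tangent_space M p"
  unfolding vector_fields_on_def by blast

lemma vector_fields_on_smooth:
  assumes "X \<in> vector_fields_on M U" "open_in M W" "W \<subseteq> U" "smooth_fun_on M W f"
  shows "smooth_fun_on M W (deriv_along X f)"
  using assms unfolding vector_fields_on_def by blast

lemma vector_fields_on_subset: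
  "X \<in> vector_fields_on M U \<Longrightarrow> V \<subseteq> U \<Longrightarrow> X \<in> vector_fields_on M V"
  unfolding vector_fields_on_def by blast

lemma vector_fields_on_add:
  assumes "smooth_manifold M" "X \<in> vector_fields_on M U" "Y \<in> vector_fields_on M U"
  shows "X + Y \<in> vector_fields_on M U"
proof -
  have "deriv_along (X + Y) f = (\<lambda>p. deriv_along X f p + deriv_along Y f p)" for f
    by (simp add: deriv_along_def)
  then show ?thesis
    using assms(2,3) smooth_fun_on_add[OF assms(1)] subspace_add[OF subspace_tangent_space[of M]]
    unfolding vector_fields_on_def by auto
qed

lemma vector_fields_on_fun_smult:
  assumes "smooth_manifold M" "X \<in> vector_fields_on M U" "smooth_fun_on M U h"
  shows "fun_smult h X \<in> vector_fields_on M U"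
proof -
  have "deriv_along (fun_smult h X) f = (\<lambda>p. h p * deriv_along X f p)" for f
    by (simp add: deriv_along_def fun_smult_def)
  then show ?thesis
    using assms(2) smooth_fun_on_mult[OF assms(1)] smooth_fun_on_subset[OF assms(3)]
      subspace_scale[OF subspace_tangent_space[of M]]
    unfolding vector_fields_on_def by (auto simp: fun_smult_def)
qed

text \<open>The value of \<open>deriv_along X f\<close> at \<open>q\<close> involves
  \<open>X\<close> only through \<open>X q\<close>, so agreement of \<open>X\<close> with
  \<open>Y\<close> on \<open>V\<close> carries smoothness over. Each \<open>Y\<close> needs to be a
  field on its own \<open>V\<close> only, which is why local fields can be glued without extending
  them.\<close>

lemma vector_fields_on_local:
  assumes "smooth_manifold M"
    and "\<And>p. p \<in> U \<Longrightarrow> \<exists>V Y. open_in M V \<and> p \<in> V \<and> Y \<in> vector_fields_on M V \<and> (\<forall>q\<in>V. X q = Y q)"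
  shows "X \<in> vector_fields_on M U"
  unfolding vector_fields_on_def
proof (intro CollectI conjI ballI allI impI)
  fix p assume "p \<in> U"
  then obtain V Y where "p \<in> V" "Y \<in> vector_fields_on M V" "\<forall>q\<in>V. X q = Y q"
    using assms(2)[OF \<open>p \<in> U\<close>] by blast
  then show "X p \<in> tangent_space M p"
    using vector_fields_on_tangent[of Y M V p] by simp
next
  fix W f assume W: "open_in M W" "W \<subseteq> U" "smooth_fun_on M W f"
  show "smooth_fun_on M W (deriv_along X f)"
  proof (rule smooth_fun_on_local[OF assms(1)])
    fix p assume "p \<in> W"
    then obtain V Y where V: "open_in M V" "p \<in> V" "Y \<in> vector_fields_on M V" "\<forall>q\<in>V. X q = Y q"
      using assms(2)[OF subsetD[OF W(2)]] by blast
    \<comment> \<open>On \<open>V \<inter> W\<close> both \<open>Y\<close> is a smooth field and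
      \<open>f\<close> is a smooth function.\<close>
    have o: "open_in M (V \<inter> W)"
      using V(1) W(1) by blast
    have "smooth_fun_on M (V \<inter> W) (deriv_along Y f)"
      using vector_fields_on_smooth[OF V(3) o] smooth_fun_on_subset[OF W(3)] by simp
    then have "smooth_fun_on M (V \<inter> W) (deriv_along X f)"
      by (rule smooth_fun_on_cong[OF assms(1) o]) (use V(4) in \<open>simp add: deriv_along_def\<close>)
    then show "\<exists>V. open_in M V \<and> p \<in> V \<and> smooth_fun_on M V (deriv_along X f)"
      using o V(2) \<open>p \<in> W\<close> by blast
  qed
qed


section \<open>Orthogonal projections\<close>

lemma riemannian_metric_pointwise:
  assumes "riemannian_metric M g" "p \<in> points M" "u \<in> tangent_space M p" "v \<in> tangent_space M p"
  shows riemannian_metric_commute: "g p u v = g p v u"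
    and riemannian_metric_add_left: "w \<in> tangent_space M p \<Longrightarrow> g p (u + v) w = g p u w + g p v w"
    and riemannian_metric_scale_left: "g p (c *\<^sub>R u) v = c * g p u v"
    and riemannian_metric_diff_left: "w \<in> tangent_space M p \<Longrightarrow> g p (u - v) w = g p u w - g p v w"
proof -
  note g = assms(1)[unfolded riemannian_metric_def, THEN conjunct1, THEN bspec, OF assms(2)]
  note sym = g[THEN conjunct2, THEN conjunct1, THEN bspec, THEN bspec]
    and lin = g[THEN conjunct1, THEN bspec, THEN bspec, THEN bspec, THEN spec]
  show "g p u v = g p v u"
    by (rule sym[OF assms(3,4)])
  have add: "g p (a + b) w = g p a w + g p b w"
    if "a \<in> tangent_space M p" "b \<in> tangent_space M p" "w \<in> tangent_space M p" for a b w
    by (rule lin[OF that, THEN conjunct1])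
  then show "w \<in> tangent_space M p \<Longrightarrow> g p (u + v) w = g p u w + g p v w"
    using assms(3,4) .
  show "g p (c *\<^sub>R u) v = c * g p u v"
    by (rule lin[OF assms(3,3,4), THEN conjunct2])
  \<comment> \<open>Additivity is applied to the sum \<open>(u - v) + v\<close>.\<close>
  show "w \<in> tangent_space M p \<Longrightarrow> g p (u - v) w = g p u w - g p v w"
    using add[OF subspace_diff[OF subspace_tangent_space assms(3,4)] assms(4)] by simp
qed

lemma riemannian_metric_pos:
  assumes "riemannian_metric M g" "p \<in> points M" "u \<in> tangent_space M p" "u \<noteq> 0"
  shows "g p u u > 0"
  using assms(1)[unfolded riemannian_metric_def, THEN conjunct1, THEN bspec, OF assms(2),
      THEN conjunct2, THEN conjunct2, THEN bspec, OF assms(3)] assms(4) by (rule mp)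

lemma riemannian_metric_zero_right:
  assumes "riemannian_metric M g" "p \<in> points M" "u \<in> tangent_space M p"
  shows "g p u 0 = 0"
  using riemannian_metric_scale_left[OF assms(1,2,3,3), of 0]
    riemannian_metric_commute[OF assms(1,2,3) subspace_0[OF subspace_tangent_space]]
    riemannian_metric_scale_left[OF assms(1,2) subspace_0[OF subspace_tangent_space] assms(3), of 0]
  by simp

text \<open>Together with \<open>span_minimal\<close> it extends orthogonality from the vectors of a
  frame to the whole fibre.\<close>

lemma subspace_orthogonal:
  assumes "riemannian_metric M g" "p \<in> points M" "u \<in> tangent_space M p"
  shows "subspace {w \<in> tangent_space M p. g p u w = 0}"
proof -
  note c = riemannian_metric_commute[OF assms]
  show ?thesis
    unfolding subspace_def
    using riemannian_metric_zero_right[OF assms] assms subspace_tangent_space[of M p]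
    by (auto simp: c subspace_add subspace_scale subspace_0
        riemannian_metric_add_left[OF assms(1,2)] riemannian_metric_scale_left[OF assms(1,2)])
qed

lemma regular_distribution_tangent:
  assumes "regular_distribution M n D" "p \<in> points M"
  shows "D p \<subseteq> tangent_space M p" "subspace (D p)"
proof -
  obtain U E where "p \<in> U" and E: "\<forall>i<n. E i \<in> vector_fields_on M U"
    and s: "span ((\<lambda>i. E i p) ` {..<n}) = D p"
    using assms unfolding regular_distribution_def by meson
  then have "(\<lambda>i. E i p) ` {..<n} \<subseteq> tangent_space M p"
    using vector_fields_on_tangent[of _ M U p] by (auto simp: image_subset_iff)
  from span_minimal[OF this subspace_tangent_space]
  show "D p \<subseteq> tangent_space M p"
    unfolding s .
  show "subspace (D p)"
    unfolding s[symmetric] by (rule subspace_span)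
qed

text \<open>Gram-Schmidt without normalisation, as an induction on \<open>k\<close> for all fields
  \<open>V\<close> at once. The induction hypothesis is used twice, for the next frame field
  \<open>E k\<close> and for \<open>V\<close> itself; subtracting from the second result its
  component along the first keeps everything smooth.\<close>

lemma local_orthogonal_part:
  fixes n k :: nat
  assumes M: "smooth_manifold M" and g: "riemannian_metric M g" and U: "open_in M U"
    and E: "\<And>i. i < n \<Longrightarrow> E i \<in> vector_fields_on M U"
    and inj: "\<And>q. q \<in> U \<Longrightarrow> inj_on (\<lambda>i. E i q) {..<n}"
    and indep: "\<And>q. q \<in> U \<Longrightarrow> independent ((\<lambda>i. E i q) ` {..<n})"
    and k: "k \<le> n" and V: "V \<in> vector_fields_on M U"
  shows "\<exists>V' \<in> vector_fields_on M U. \<forall>q\<in>U.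
    V q - V' q \<in> span ((\<lambda>i. E i q) ` {..<k}) \<and> (\<forall>i<k. g q (V' q) (E i q) = 0)"
  using k V
proof (induction k arbitrary: V)
  case 0
  then show ?case by (intro bexI[of _ V]) auto
next
  case (Suc k)
  note tangent = vector_fields_on_tangent
  let ?S = "\<lambda>k q. span ((\<lambda>i. E i q) ` {..<k})"
  have E': "E i \<in> vector_fields_on M U" if "i \<le> k" for i
    using E Suc.prems(1) that by simp
  \<comment> \<open>\<open>F\<close> is the next Gram-Schmidt field, the part of \<open>E k\<close>
    orthogonal to the earlier frame fields.\<close>
  obtain F where F: "F \<in> vector_fields_on M U"
    and FE: "\<And>q. q \<in> U \<Longrightarrow> E k q - F q \<in> ?S k q"
    and Fo: "\<And>q i. q \<in> U \<Longrightarrow> i < k \<Longrightarrow> g q (F q) (E i q) = 0"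
    using Suc.IH[OF Suc_leD[OF Suc.prems(1)] E'[OF order_refl]] by blast
  obtain V' where V': "V' \<in> vector_fields_on M U"
    and VV: "\<And>q. q \<in> U \<Longrightarrow> V q - V' q \<in> ?S k q"
    and Vo: "\<And>q i. q \<in> U \<Longrightarrow> i < k \<Longrightarrow> g q (V' q) (E i q) = 0"
    using Suc.IH[OF Suc_leD[OF Suc.prems(1)] Suc.prems(2)] by blast
  have pt: "q \<in> points M" if "q \<in> U" for q
    using that openin_subset[OF U] by blast
  \<comment> \<open>If \<open>F q\<close> were 0, then \<open>E k q\<close> would depend linearly on
    the earlier vectors. Since independence is stated for the set of frame vectors, injectivity is
    needed to exclude that \<open>E k q\<close> equals one of them.\<close>
  have F0: "F q \<noteq> 0" if q: "q \<in> U" for q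
  proof
    assume "F q = 0"
    then have 1: "E k q \<in> ?S k q" using FE[OF q] by simp
    have "E k q \<notin> (\<lambda>i. E i q) ` {..<k}"
      using inj[OF q] Suc.prems(1) by (auto dest!: inj_onD)
    moreover have "independent (insert (E k q) ((\<lambda>i. E i q) ` {..<k}))"
      by (rule independent_mono[OF indep[OF q]]) (use Suc.prems(1) in auto)
    ultimately show False
      using 1 independent_insert by metis
  qed
  \<comment> \<open>\<open>c\<close> is the solution of
    \<open>g q (V' q + c q *\<^sub>R F q) (F q) = 0\<close>; the division is legitimate because
    \<open>F\<close> vanishes nowhere on \<open>U\<close>.\<close>
  define c where "c = (\<lambda>q. - 1 * (g q (V' q) (F q) * inverse (g q (F q) (F q))))"
  have smooth_g: "smooth_fun_on M U (\<lambda>q. g q (X q) (Y q))"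
    if "X \<in> vector_fields_on M U" "Y \<in> vector_fields_on M U" for X Y
    using g[unfolded riemannian_metric_def, THEN conjunct2, rule_format, OF U that] .
  have gF: "g q (F q) (F q) \<noteq> 0" if "q \<in> U" for q
    using riemannian_metric_pos[OF g pt tangent F0, OF that F that that] by simp
  have c: "smooth_fun_on M U c"
    unfolding c_def
    by (intro smooth_fun_on_mult[OF M U] smooth_fun_on_const[OF M U] smooth_fun_on_inverse[OF M U]
        smooth_g V' F gF)
  define V'' where "V'' = V' + fun_smult c F"
  have V'': "V'' \<in> vector_fields_on M U"
    unfolding V''_def by (intro vector_fields_on_add vector_fields_on_fun_smult M V' F c)
  have "V q - V'' q \<in> ?S (Suc k) q \<and> (\<forall>i<Suc k. g q (V'' q) (E i q) = 0)" if q: "q \<in> U" for q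
  proof
    have mono: "?S k q \<subseteq> ?S (Suc k) q"
      by (rule span_mono) auto
    have "E k q - (E k q - F q) \<in> ?S (Suc k) q"
      by (rule span_diff) (use FE[OF q] mono in \<open>auto intro: span_base\<close>)
    then have "F q \<in> ?S (Suc k) q" by simp
    then have "(V q - V' q) - c q *\<^sub>R F q \<in> ?S (Suc k) q"
      by (rule span_diff[OF subsetD[OF mono VV[OF q]] span_scale])
    then show "V q - V'' q \<in> ?S (Suc k) q"
      by (simp add: V''_def fun_smult_def algebra_simps)
    note tV = tangent[OF V' q] and tF = tangent[OF F q] and tV'' = tangent[OF V'' q]
    have expand: "g q (V'' q) w = g q (V' q) w + c q * g q (F q) w"
      if "w \<in> tangent_space M q" for w
      using riemannian_metric_add_left[OF g pt[OF q] tV _ that, of "c q *\<^sub>R F q"]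
        riemannian_metric_scale_left[OF g pt[OF q] tF that]
        subspace_scale[OF subspace_tangent_space tF]
      by (simp add: V''_def fun_smult_def)
    have sub: "subspace {w \<in> tangent_space M q. g q (V'' q) w = 0}"
      by (rule subspace_orthogonal[OF g pt[OF q] tV''])
    have lt: "E i q \<in> {w \<in> tangent_space M q. g q (V'' q) w = 0}" if "i < k" for i
      using expand[OF tangent[OF E' q]] Vo[OF q that] Fo[OF q that] tangent[OF E' q] that by simp
    \<comment> \<open>Orthogonality to \<open>E k q\<close> is obtained from the splitting
      \<open>(E k q - F q) + F q\<close>: the first summand lies in the span of the earlier vectors,
      the second is handled by the choice of \<open>c\<close>.\<close>
    have "?S k q \<subseteq> {w \<in> tangent_space M q. g q (V'' q) w = 0}"
      by (rule span_minimal[OF image_subsetI sub]) (rule lt, simp)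
    from subsetD[OF this FE[OF q]]
    have "E k q - F q \<in> {w \<in> tangent_space M q. g q (V'' q) w = 0}" .
    moreover have "F q \<in> {w \<in> tangent_space M q. g q (V'' q) w = 0}"
      using expand[OF tF] gF[OF q] tF by (simp add: c_def)
    ultimately have "E k q - F q + F q \<in> {w \<in> tangent_space M q. g q (V'' q) w = 0}"
      by (rule subspace_add[OF sub])
    then show "\<forall>i<Suc k. g q (V'' q) (E i q) = 0"
      using lt by (auto simp: less_Suc_eq)
  qed
  then show ?case
    by (intro bexI[OF _ V'']) blast
qed

text \<open>Two candidates differ by a vector that lies in \<open>D p\<close> and is orthogonal to
  \<open>D p\<close>, hence to itself, so positivity of \<open>g\<close> makes the difference 0.
  This resolves the definite description.\<close>

lemma orth_proj_complement_eqI: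
  assumes g: "riemannian_metric M g" and D: "regular_distribution M n D" and p: "p \<in> points M"
    and w: "w \<in> orth_complement M g D p" "v - w \<in> D p"
  shows "orth_proj_complement M g D p v = w"
  unfolding orth_proj_complement_def
proof (rule the_equality)
  show "w \<in> orth_complement M g D p \<and> v - w \<in> D p"
    using w by simp
  fix w' assume w': "w' \<in> orth_complement M g D p \<and> v - w' \<in> D p"
  have "(v - w) - (v - w') \<in> D p"
    using w w' regular_distribution_tangent(2)[OF D p] subspace_diff by blast
  then have d: "w' - w \<in> D p" by simp
  then have t: "w' - w \<in> tangent_space M p"
    using regular_distribution_tangent(1)[OF D p] by blast
  have tw: "w \<in> tangent_space M p" "w' \<in> tangent_space M p"
    and 0: "g p w (w' - w) = 0" "g p w' (w' - w) = 0"
    using w w' d unfolding orth_complement_def by auto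
  have "g p (w' - w) (w' - w) = 0"
    using riemannian_metric_diff_left[OF g p tw(2,1) t] 0 by simp
  then show "w' = w"
    using riemannian_metric_pos[OF g p t] by force
qed

text \<open>For \<open>k = n\<close> the Gram-Schmidt field is orthogonal to a full frame and hence
  to the fibres it spans. By uniqueness it is the pointwise projection, which is therefore smooth
  near \<open>p\<close>.\<close>

lemma local_orth_proj_complement:
  assumes M: "smooth_manifold M" and g: "riemannian_metric M g" and D: "regular_distribution M n D"
    and X: "X \<in> vector_fields_on M (points M)" and p: "p \<in> points M"
  shows "\<exists>U. open_in M U \<and> p \<in> U \<and> (\<exists>Y\<in>vector_fields_on M U. \<forall>q\<in>U.
    Y q \<in> orth_complement M g D q \<and> X q - Y q \<in> D q \<and> orth_proj_complement M g D q (X q) = Y q)"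
proof -
  obtain U E where U: "open_in M U" "p \<in> U" and E: "\<forall>i<n. E i \<in> vector_fields_on M U"
    and fr: "\<forall>q\<in>U. inj_on (\<lambda>i. E i q) {..<n} \<and> independent ((\<lambda>i. E i q) ` {..<n}) \<and>
          span ((\<lambda>i. E i q) ` {..<n}) = D q"
    using D[unfolded regular_distribution_def, THEN bspec, OF p] by (elim exE conjE) (rule that)
  have sub: "U \<subseteq> points M" by (rule openin_subset[OF U(1)])
  have "\<exists>Y\<in>vector_fields_on M U. \<forall>q\<in>U. X q - Y q \<in> span ((\<lambda>i. E i q) ` {..<n}) \<and>
      (\<forall>i<n. g q (Y q) (E i q) = 0)"
    by (rule local_orthogonal_part[OF M g U(1), where n = n])
       (use E fr vector_fields_on_subset[OF X sub] in simp_all)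
  then obtain Y where Y: "Y \<in> vector_fields_on M U"
    and 1: "\<And>q. q \<in> U \<Longrightarrow> X q - Y q \<in> span ((\<lambda>i. E i q) ` {..<n})"
    and 2: "\<And>q i. q \<in> U \<Longrightarrow> i < n \<Longrightarrow> g q (Y q) (E i q) = 0"
    by blast
  have "Y q \<in> orth_complement M g D q \<and> X q - Y q \<in> D q \<and>
    orth_proj_complement M g D q (X q) = Y q" if q: "q \<in> U" for q
  proof -
    have qp: "q \<in> points M" using q sub by blast
    have t: "Y q \<in> tangent_space M q" by (rule vector_fields_on_tangent[OF Y q])
    have "span ((\<lambda>i. E i q) ` {..<n}) \<subseteq> {w \<in> tangent_space M q. g q (Y q) w = 0}"
      by (rule span_minimal[OF _ subspace_orthogonal[OF g qp t]])
         (use E 2[OF q] vector_fields_on_tangent[of _ M U q] q in auto)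
    then have o: "Y q \<in> orth_complement M g D q"
      using t fr q unfolding orth_complement_def by auto
    moreover have "X q - Y q \<in> D q"
      using 1[OF q] fr q by auto
    ultimately show ?thesis
      using orth_proj_complement_eqI[OF g D qp] by blast
  qed
  then show ?thesis
    by (intro exI[of _ U] conjI U bexI[OF _ Y] ballI) blast+
qed

text \<open>The projection is determined at each point independently of any frame, so the local
  fields automatically fit together.\<close>

lemma orth_proj_complement_field:
  assumes M: "smooth_manifold M" and g: "riemannian_metric M g" and D: "regular_distribution M n D"
    and X: "X \<in> vector_fields M"
  obtains Z where "Z \<in> sections M (orth_complement M g D)"
    and "\<And>p. p \<in> points M \<Longrightarrow> Z p = orth_proj_complement M g D p (X p)"
    and "\<And>p. p \<in> points M \<Longrightarrow> X p - Z p \<in> D p"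
proof
  \<comment> \<open>The value 0 off the manifold is the normalisation demanded by
    \<open>vector_fields\<close>.\<close>
  define Z where "Z = (\<lambda>p. if p \<in> points M then orth_proj_complement M g D p (X p) else 0)"
  have X': "X \<in> vector_fields_on M (points M)"
    using X unfolding vector_fields_def by blast
  note loc = local_orth_proj_complement[OF M g D X']
  have "Z \<in> vector_fields_on M (points M)"
  proof (rule vector_fields_on_local[OF M])
    fix p assume "p \<in> points M"
    from loc[OF this]
    obtain U Y where U: "open_in M U" "p \<in> U" "Y \<in> vector_fields_on M U"
      and Y: "\<forall>q\<in>U. orth_proj_complement M g D q (X q) = Y q"
      by blast
    then have "\<forall>q\<in>U. Z q = Y q"
      using openin_subset[OF U(1)] by (auto simp: Z_def)
    with U show "\<exists>V Y. open_in M V \<and> p \<in> V \<and> Y \<in> vector_fields_on M V \<and> (\<forall>q\<in>V. Z q = Y q)"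
      by blast
  qed
  moreover have Zp: "Z p \<in> orth_complement M g D p \<and> X p - Z p \<in> D p" if "p \<in> points M" for p
  proof -
    obtain U Y where "p \<in> U" and "\<forall>q\<in>U. Y q \<in> orth_complement M g D q \<and> X q - Y q \<in> D q \<and>
        orth_proj_complement M g D q (X q) = Y q"
      using loc[OF \<open>p \<in> points M\<close>] by blast
    then show ?thesis using that by (simp add: Z_def)
  qed
  ultimately show "Z \<in> sections M (orth_complement M g D)"
    unfolding sections_def vector_fields_def by (auto simp: Z_def)
  show "Z p = orth_proj_complement M g D p (X p)" if "p \<in> points M" for p
    using that by (simp add: Z_def)
  show "X p - Z p \<in> D p" if "p \<in> points M" for p
    using Zp that by blast
qed


section \<open>The two characterisations\<close>

lemma sections_complement_orthogonal:
  assumes "Z \<in> sections M (orth_complement M g D)" "p \<in> points M" "w \<in> D p"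
  shows "g p (Z p) w = 0"
  using assms unfolding sections_def orth_complement_def by blast

lemma vector_fields_tangent: "X \<in> vector_fields M \<Longrightarrow> p \<in> points M \<Longrightarrow> X p \<in> tangent_space M p"
  unfolding vector_fields_def by (auto intro: vector_fields_on_tangent)

lemma sections_vector_fields: "X \<in> sections M D \<Longrightarrow> X \<in> vector_fields M"
  unfolding sections_def by blast

lemma levi_civita_vector_fields:
  assumes "levi_civita_connection M g nabla" "X \<in> vector_fields M" "Y \<in> vector_fields M"
  shows "nabla X Y \<in> vector_fields M"
proof -
  have "affine_connection M nabla"
    using assms(1) unfolding levi_civita_connection_def by (rule conjunct1)
  then have "\<forall>X\<in>vector_fields M. \<forall>Y\<in>vector_fields M. nabla X Y \<in> vector_fields M"
    unfolding affine_connection_def by (rule conjunct1)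
  with assms(2,3) show ?thesis by blast
qed

lemma levi_civita_torsion_free:
  assumes "levi_civita_connection M g nabla" "X \<in> vector_fields M" "Y \<in> vector_fields M"
  shows "bracket M X Y = nabla X Y - nabla Y X"
  by (rule assms(1)[unfolded levi_civita_connection_def, THEN conjunct2, THEN conjunct1,
        THEN bspec, THEN bspec, OF assms(2,3), symmetric])

text \<open>By torsion-freeness the bracket is a difference of covariant derivatives, which are
  vector fields by the axioms of a connection. No computation with second derivatives is
  required.\<close>

lemma bracket_vector_fields:
  assumes M: "smooth_manifold M" and L: "levi_civita_connection M g nabla"
    and XY: "X \<in> vector_fields M" "Y \<in> vector_fields M"
  shows "bracket M X Y \<in> vector_fields M"
proof -
  have n: "nabla X Y \<in> vector_fields M" "nabla Y X \<in> vector_fields M"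
    and b: "bracket M X Y = nabla X Y - nabla Y X"
    using levi_civita_vector_fields[OF L] levi_civita_torsion_free[OF L] XY by blast+
  have "nabla X Y + fun_smult (\<lambda>p. - 1) (nabla Y X) \<in> vector_fields_on M (points M)"
    by (intro vector_fields_on_add vector_fields_on_fun_smult smooth_fun_on_const M)
       (use n in \<open>auto simp: vector_fields_def\<close>)
  moreover have "nabla X Y + fun_smult (\<lambda>p. - 1) (nabla Y X) = bracket M X Y"
    unfolding b by (simp add: fun_eq_iff fun_smult_def)
  ultimately show ?thesis
    using n unfolding vector_fields_def b by auto
qed

lemma sections_in_distribution: "X \<in> sections M D \<Longrightarrow> p \<in> points M \<Longrightarrow> X p \<in> D p"
  unfolding sections_def by blast

lemma involutive_iff_bracket_orthogonal:
  assumes M: "smooth_manifold M" and g: "riemannian_metric M g"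
    and L: "levi_civita_connection M g nabla" and D: "regular_distribution M n D"
  shows "involutive M D \<longleftrightarrow>
    (\<forall>Z\<in>sections M (orth_complement M g D). \<forall>X\<in>sections M D. \<forall>Y\<in>sections M D. \<forall>p\<in>points M.
       g p (Z p) (bracket M X Y p) = 0)" (is "_ \<longleftrightarrow> ?R")
proof
  assume inv: "involutive M D"
  show ?R
  proof (intro ballI)
    fix Z X Y p
    assume Z: "Z \<in> sections M (orth_complement M g D)" and "X \<in> sections M D" "Y \<in> sections M D"
      and p: "p \<in> points M"
    then have "bracket M X Y \<in> sections M D"
      using inv unfolding involutive_def by blast
    then show "g p (Z p) (bracket M X Y p) = 0"
      by (intro sections_complement_orthogonal[OF Z p] sections_in_distribution[OF _ p])
  qed
next
  assume R: ?R
  show "involutive M D"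
    unfolding involutive_def
  proof (intro ballI)
    fix X Y assume XY: "X \<in> sections M D" "Y \<in> sections M D"
    let ?B = "bracket M X Y"
    have B: "?B \<in> vector_fields M"
      using bracket_vector_fields[OF M L] XY sections_vector_fields by blast
    \<comment> \<open>The test section is the component of the bracket orthogonal to
      \<open>D\<close>.\<close>
    obtain Z where Z: "Z \<in> sections M (orth_complement M g D)"
      and BZ: "\<And>p. p \<in> points M \<Longrightarrow> ?B p - Z p \<in> D p"
      using orth_proj_complement_field[OF M g D B] by metis
    have "?B p \<in> D p" if p: "p \<in> points M" for p
    proof -
      have t: "?B p \<in> tangent_space M p" "Z p \<in> tangent_space M p"
        using vector_fields_tangent[OF _ p] B Z sections_vector_fields by blast+
      \<comment> \<open>As \<open>?B p - Z p\<close> lies in \<open>D p\<close>, it is orthogonal to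
        \<open>Z p\<close>, so \<open>g p (Z p) (Z p)\<close> equals
        \<open>g p (?B p) (Z p)\<close>, which is 0 by \<open>R\<close>.\<close>
      have "g p (?B p) (Z p) - g p (Z p) (Z p) = g p (?B p - Z p) (Z p)"
        using riemannian_metric_diff_left[OF g p t t(2)] by simp
      also have "\<dots> = g p (Z p) (?B p - Z p)"
        by (rule riemannian_metric_commute[OF g p subspace_diff[OF subspace_tangent_space t] t(2)])
      also have "\<dots> = 0"
        by (rule sections_complement_orthogonal[OF Z p BZ[OF p]])
      finally have "g p (Z p) (Z p) = 0"
        using R Z XY p riemannian_metric_commute[OF g p t] by auto
      then have "Z p = 0"
        using riemannian_metric_pos[OF g p t(2)] by force
      then show ?thesis using BZ[OF p] by simp
    qed
    with B show "?B \<in> sections M D"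
      unfolding sections_def by blast
  qed
qed

lemma second_fundamental_form_along_eq:
  assumes M: "smooth_manifold M" and g: "riemannian_metric M g"
    and L: "levi_civita_connection M g nabla" and D: "regular_distribution M n D"
    and Z: "Z \<in> sections M (orth_complement M g D)"
    and XY: "X \<in> vector_fields M" "Y \<in> vector_fields M" and p: "p \<in> points M"
  shows "second_fundamental_form_along M g nabla D Z X Y p = g p (Z p) (nabla X Y p)"
proof -
  have n: "nabla X Y \<in> vector_fields M"
    by (rule levi_civita_vector_fields[OF L XY])
  obtain W where W: "W \<in> sections M (orth_complement M g D)"
    and eq: "W p = orth_proj_complement M g D p (nabla X Y p)"
    and d: "nabla X Y p - W p \<in> D p"
    using orth_proj_complement_field[OF M g D n] p by metis
  have t: "nabla X Y p \<in> tangent_space M p" "W p \<in> tangent_space M p" "Z p \<in> tangent_space M p"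
    using vector_fields_tangent[OF _ p] n W Z sections_vector_fields by blast+
  have "g p (nabla X Y p) (Z p) - g p (W p) (Z p) = g p (nabla X Y p - W p) (Z p)"
    using riemannian_metric_diff_left[OF g p t] by simp
  also have "\<dots> = g p (Z p) (nabla X Y p - W p)"
    by (rule riemannian_metric_commute[OF g p subspace_diff[OF subspace_tangent_space t(1,2)] t(3)])
  also have "\<dots> = 0"
    by (rule sections_complement_orthogonal[OF Z p d])
  finally show ?thesis
    using eq riemannian_metric_commute[OF g p t(1,3)]
    by (simp add: second_fundamental_form_along_def second_fundamental_form_def)
qed

text \<open>Once the projections are dropped, the difference is the pairing of \<open>Z\<close> with
  \<open>nabla X Y - nabla Y X\<close>, which torsion-freeness identifies with the bracket.\<close>

lemma second_fundamental_form_along_antisym: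
  assumes M: "smooth_manifold M" and g: "riemannian_metric M g"
    and L: "levi_civita_connection M g nabla" and D: "regular_distribution M n D"
    and Z: "Z \<in> sections M (orth_complement M g D)"
    and XY: "X \<in> vector_fields M" "Y \<in> vector_fields M" and p: "p \<in> points M"
  shows "second_fundamental_form_along M g nabla D Z X Y p
    - second_fundamental_form_along M g nabla D Z Y X p = g p (Z p) (bracket M X Y p)"
proof -
  have n: "nabla X Y \<in> vector_fields M" "nabla Y X \<in> vector_fields M"
    and b: "bracket M X Y = nabla X Y - nabla Y X"
    using levi_civita_vector_fields[OF L] levi_civita_torsion_free[OF L] XY by blast+
  have t: "nabla X Y p \<in> tangent_space M p" "nabla Y X p \<in> tangent_space M p" "Z p \<in> tangent_space M p"
    using vector_fields_tangent[OF _ p] n Z sections_vector_fields by blast+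
  have "g p (bracket M X Y p) (Z p) = g p (nabla X Y p) (Z p) - g p (nabla Y X p) (Z p)"
    using riemannian_metric_diff_left[OF g p t] b by simp
  moreover have "bracket M X Y p \<in> tangent_space M p"
    using b subspace_diff[OF subspace_tangent_space t(1,2)] by simp
  ultimately show ?thesis
    using second_fundamental_form_along_eq[OF M g L D Z] XY p t
      riemannian_metric_commute[OF g p t(3)] by simp
qed

lemma ext_deriv_interior_metric:
  assumes M: "smooth_manifold M"
    and Z: "Z \<in> sections M (orth_complement M g D)"
    and XY: "X \<in> sections M D" "Y \<in> sections M D" and p: "p \<in> points M"
  shows "ext_deriv M (interior_metric g Z) X Y p = - g p (Z p) (bracket M X Y p)"
proof -
  \<comment> \<open>The differentiated function is 0 on the manifold but may have arbitrary values
    of \<open>g\<close> outside it, so it need not be the zero function;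
    \<open>tangent_space_vanish\<close> with \<open>U = points M\<close> still gives derivative
    0.\<close>
  have 0: "V p (\<lambda>q. g q (Z q) (W q)) = 0" if "V \<in> sections M D" "W \<in> sections M D" for V W
  proof (rule tangent_space_vanish[OF M _ openin_topspace p, where v = "V p"])
    show "V p \<in> tangent_space M p"
      by (rule vector_fields_tangent[OF sections_vector_fields[OF that(1)] p])
    show "g q (Z q) (W q) = 0" if "q \<in> points M" for q
      by (rule sections_complement_orthogonal[OF Z that
            sections_in_distribution[OF \<open>W \<in> sections M D\<close> that]])
  qed
  show ?thesis
    by (simp add: 0[OF XY] 0[OF XY(2,1)] ext_deriv_def interior_metric_def deriv_along_def)
qed

theorem theorem12:
  fixes M :: "('a, 'e::real_inner) manifold"
    and g :: "'a metric_field"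
    and nabla :: "'a connection"
    and D :: "'a distribution"
    and n :: nat
  assumes "smooth_manifold M"
    and "riemannian_metric M g"
    and "levi_civita_connection M g nabla"
    and "regular_distribution M n D"
  shows "(involutive M D \<longleftrightarrow>
           (\<forall>Z\<in>sections M (orth_complement M g D). \<forall>X\<in>sections M D. \<forall>Y\<in>sections M D. \<forall>p\<in>points M.
              second_fundamental_form_along M g nabla D Z X Y p
                = second_fundamental_form_along M g nabla D Z Y X p)) \<and>
         (involutive M D \<longleftrightarrow>
           (\<forall>Z\<in>sections M (orth_complement M g D). \<forall>X\<in>sections M D. \<forall>Y\<in>sections M D. \<forall>p\<in>points M.
              ext_deriv M (interior_metric g Z) X Y p = 0))"
proof -
  note iff = involutive_iff_bracket_orthogonal[OF assms]
  note B = second_fundamental_form_along_antisym[OF assms _ sections_vector_fields sections_vector_fields]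
  note d = ext_deriv_interior_metric[OF assms(1)]
  \<comment> \<open>With involutivity replaced by the bracket condition, both equivalences hold for
    each \<open>Z\<close>, \<open>X\<close>, \<open>Y\<close> and \<open>p\<close> separately: the
    pairing with the bracket is the antisymmetric difference in the first and the negative of the
    exterior derivative in the second.\<close>
  show ?thesis
    unfolding iff by (intro conjI ball_cong refl) (auto simp: d B[symmetric])
qed

end
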